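(* Let $k\ge1$ be an integer, let $\tau>0$, let $(\xi(s))_{s\in\mathbb{Z}}$ be a stationary sequence of real random variables, and let $(u_n)$ be a sequence of positive numbers with $n\,\mathbb{P}(\xi(0)>u_n)\to\tau$ as $n\to\infty$. Assume that $$\limsup_{n\to\infty}\,n\,\mathbb{P}\Big(\xi(0)>u_n\text{ and there exists }s\in\{-k+1,\dots,k-1\}\setminus\{0\}\text{ such that }\xi(s)>u_n\Big)<\tau.$$ Then the sequence $(\xi(S_n))_{n\ge0}$ does not satisfy the $D^{(k)}(u_n)$ condition.
   Context: Random walk: $S_0=0$, $S_n=X_1+\cdots+X_n$ for $n\ge1$, where $(X_i)_{i\ge1}$ are independent with $\mathbb{P}(X_i=1)=p$, $\mathbb{P}(X_i=-1)=1-p$, $p\in(0,1)\setminus\{1/2\}$. The sequence $(\xi(s))_{s\in\mathbb{Z}}$ is independent of $(X_i)_{i\ge1}$. $\Delta(u_n)$ condition: let $\zeta(i)=\xi(S_i)$, $i\ge0$. For $0\le m_1\le m_2\le n$ let $\mathcal{B}_{m_1}^{m_2}(u_n)$ be the $\sigma$-field generated by the events $\{\zeta(s)\le u_n\}$, $m_1\le s\le m_2$, and for $1\le\ell\le n-1$ let $$\alpha_{n,\ell}=\max_{1\le j\le n-\ell}\ \max_{A\in\mathcal{B}_0^j(u_n),\,B\in\mathcal{B}_{j+\ell}^n(u_n)}|\mathbb{P}(A\cap B)-\mathbb{P}(A)\mathbb{P}(B)|.$$ The sequence $(\zeta(i))$ satisfies $\Delta(u_n)$ if there is a sequence $(\ell_n)$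 with $\alpha_{n,\ell_n}\to0$ and $\ell_n=o(n)$. $D^{(k)}(u_n)$ condition: $(\zeta(i))$ satisfies $\Delta(u_n)$ and there exist sequences of integers $(s_n)$, $(\ell_n)$ such that $s_n\to\infty$, $s_n\alpha_{n,\ell_n}\to0$, $s_n\ell_n/n\to0$ and $$\lim_{n\to\infty}n\,\mathbb{P}\big(\zeta(0)>u_n\ge M_{1,k-1},\ M_{k,r_n}>u_n\big)=0,$$ where $r_n=\lfloor n/s_n\rfloor$, $M_{i,j}=\max_{i\le t\le j}\zeta(t)$ for $0\le i\le j$, and $M_{i,j}=-\infty$ for $i>j$. *)

theory Defs
  imports "HOL-Probability.Probability" "HOL-Library.Landau_Symbols"
begin

text \<open>The library's \<open>indep_var\<close> forces both random elements to have the same type; this is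
  the same condition (cf. \<open>indep_var_eq\<close>) for values in arbitrary measurable spaces.\<close>

definition indep_elems ::
    "'a measure \<Rightarrow> 'b measure \<Rightarrow> ('a \<Rightarrow> 'b) \<Rightarrow> 'c measure \<Rightarrow> ('a \<Rightarrow> 'c) \<Rightarrow> bool" where
  "indep_elems M S Y T Z \<longleftrightarrow>
     Y \<in> measurable M S \<and> Z \<in> measurable M T \<and>
     prob_space.indep_set M {Y -` A \<inter> space M | A. A \<in> sets S}
                            {Z -` B \<inter> space M | B. B \<in> sets T}"

definition stationary_seq :: "'a measure \<Rightarrow> (int \<Rightarrow> 'a \<Rightarrow> real) \<Rightarrow> bool" where
  "stationary_seq M \<xi> \<longleftrightarrow>
     (\<forall>s. \<xi> s \<in> borel_measurable M) \<and>
     (\<forall>h::int. distr M (PiM (UNIV::int set) (\<lambda>_. borel)) (\<lambda>\<omega> s. \<xi> (s + h) \<omega>)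
             = distr M (PiM (UNIV::int set) (\<lambda>_. borel)) (\<lambda>\<omega> s. \<xi> s \<omega>))"

definition walk :: "(nat \<Rightarrow> 'a \<Rightarrow> int) \<Rightarrow> nat \<Rightarrow> 'a \<Rightarrow> int" where
  "walk X n \<omega> = (\<Sum>i=1..n. X i \<omega>)"

definition scenery_along_walk ::
    "(int \<Rightarrow> 'a \<Rightarrow> real) \<Rightarrow> (nat \<Rightarrow> 'a \<Rightarrow> int) \<Rightarrow> nat \<Rightarrow> 'a \<Rightarrow> real" where
  "scenery_along_walk \<xi> X i \<omega> = \<xi> (walk X i \<omega>) \<omega>"

definition level_events ::
    "'a measure \<Rightarrow> (nat \<Rightarrow> 'a \<Rightarrow> real) \<Rightarrow> real \<Rightarrow> nat \<Rightarrow> nat \<Rightarrow> 'a set set" where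
  "level_events M \<zeta> v m\<^sub>1 m\<^sub>2 =
     sigma_sets (space M) {{\<omega> \<in> space M. \<zeta> s \<omega> \<le> v} | s. m\<^sub>1 \<le> s \<and> s \<le> m\<^sub>2}"

text \<open>The \<open>\<sigma>\<close>-fields below are generated by finitely many events, hence finite, so for
  \<open>1 \<le> l \<le> n - 1\<close> the supremum is over a finite nonempty set and is a maximum.
  Outside that range the value is meaningless; the conditions using it ask for
  \<open>1 \<le> l \<le> n - 1\<close> for all large \<open>n\<close>.\<close>

definition mixing_coeff ::
    "'a measure \<Rightarrow> (nat \<Rightarrow> 'a \<Rightarrow> real) \<Rightarrow> (nat \<Rightarrow> real) \<Rightarrow> nat \<Rightarrow> nat \<Rightarrow> real" where
  "mixing_coeff M \<zeta> u n l =
     Sup {\<bar>measure M (A \<inter> B) - measure M A * measure M B\<bar> | j A B.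
            1 \<le> j \<and> j \<le> n - l \<and>
            A \<in> level_events M \<zeta> (u n) 0 j \<and> B \<in> level_events M \<zeta> (u n) (j + l) n}"

definition Delta_cond :: "'a measure \<Rightarrow> (nat \<Rightarrow> 'a \<Rightarrow> real) \<Rightarrow> (nat \<Rightarrow> real) \<Rightarrow> bool" where
  "Delta_cond M \<zeta> u \<longleftrightarrow>
     (\<exists>l :: nat \<Rightarrow> nat.
        (\<forall>\<^sub>F n in sequentially. 1 \<le> l n \<and> l n \<le> n - 1) \<and>
        (\<lambda>n. mixing_coeff M \<zeta> u n (l n)) \<longlonglongrightarrow> 0 \<and>
        (\<lambda>n. real (l n)) \<in> o(\<lambda>n. real n))"

text \<open>In \<open>ereal\<close> the supremum of the empty set is \<open>-\<infinity>\<close>, which is the required value for \<open>i > j\<close>.\<close>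

definition partial_max :: "(nat \<Rightarrow> 'a \<Rightarrow> real) \<Rightarrow> nat \<Rightarrow> nat \<Rightarrow> 'a \<Rightarrow> ereal" where
  "partial_max \<zeta> i j \<omega> = (SUP t\<in>{i..j}. ereal (\<zeta> t \<omega>))"

definition D_cond ::
    "nat \<Rightarrow> 'a measure \<Rightarrow> (nat \<Rightarrow> 'a \<Rightarrow> real) \<Rightarrow> (nat \<Rightarrow> real) \<Rightarrow> bool" where
  "D_cond k M \<zeta> u \<longleftrightarrow>
     Delta_cond M \<zeta> u \<and>
     (\<exists>(s :: nat \<Rightarrow> nat) (l :: nat \<Rightarrow> nat).
        (\<forall>\<^sub>F n in sequentially. 1 \<le> l n \<and> l n \<le> n - 1) \<and>
        filterlim s at_top sequentially \<and>
        (\<lambda>n. real (s n) * mixing_coeff M \<zeta> u n (l n)) \<longlonglongrightarrow> 0 \<and>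
        (\<lambda>n. real (s n) * real (l n) / real n) \<longlonglongrightarrow> 0 \<and>
        (\<lambda>n. real n * \<P>(\<omega> in M. \<zeta> 0 \<omega> > u n
                              \<and> ereal (u n) \<ge> partial_max \<zeta> 1 (k - 1) \<omega>
                              \<and> partial_max \<zeta> k (nat \<lfloor>real n / real (s n)\<rfloor>) \<omega> > ereal (u n)))
          \<longlonglongrightarrow> 0)"

end

theory Submission
  imports Defs
begin

text \<open>With probability \<open>p\<^sup>k (1 - p)\<^sup>k\<close>, independently of the scenery, the walk makes \<open>k\<close> steps
  up and then \<open>k\<close> steps down. It then sees \<open>\<xi>(1), \<dots>, \<xi>(k - 1)\<close> at times \<open>1, \<dots>, k - 1\<close>
  and \<open>\<xi>(0)\<close> again at time \<open>2k\<close>, and \<open>2k \<le> r\<^sub>n\<close> for large \<open>n\<close> because \<open>s\<^sub>n/n \<rightarrow> 0\<close>. So the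
  quantity that \<open>D\<^sup>(\<^sup>k\<^sup>)(u\<^sub>n)\<close> sends to \<open>0\<close> is eventually at least \<open>p\<^sup>k (1 - p)\<^sup>k\<close> times
  \<open>n \<P>(\<xi>(0) > u\<^sub>n) - n \<P>(\<xi>(0) > u\<^sub>n, \<xi>(s) > u\<^sub>n for some 0 < |s| < k)\<close>, whose lower limit is positive.\<close>

text \<open>Trades extended-real maxima for quantifiers over finitely many times. On an empty range
  the supremum is \<open>-\<infinity>\<close> and the bound is vacuous, as it must be for the range
  \<open>1..k - 1\<close> when \<open>k = 1\<close>.\<close>

lemma partial_max_le_iff: "partial_max \<zeta> i j \<omega> \<le> ereal v \<longleftrightarrow> (\<forall>t\<in>{i..j}. \<zeta> t \<omega> \<le> v)"
  by (simp add: partial_max_def SUP_le_iff)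

lemma less_partial_max_iff: "ereal v < partial_max \<zeta> i j \<omega> \<longleftrightarrow> (\<exists>t\<in>{i..j}. v < \<zeta> t \<omega>)"
  by (simp add: partial_max_def less_SUP_iff)

text \<open>The walk is integer valued, so evaluating the scenery at its random position glues
  countably many measurable functions along measurable pieces.\<close>

lemma borel_measurable_scenery_along_walk:
  assumes "\<And>i. i \<ge> 1 \<Longrightarrow> X i \<in> measurable M (count_space UNIV)"
    and "\<And>s. \<xi> s \<in> borel_measurable M"
  shows "scenery_along_walk \<xi> X t \<in> borel_measurable M"
proof -
  have "walk X t \<in> measurable M (count_space UNIV)"
  proof (induction t)
    case 0
    then show ?case by (simp add: walk_def[abs_def])
  next
    case (Suc t)
    have [measurable]: "walk X t \<in> measurable M (count_space UNIV)"
      "X (Suc t) \<in> measurable M (count_space UNIV)"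
      using Suc assms(1) by auto
    have "walk X (Suc t) = (\<lambda>\<omega>. walk X t \<omega> + X (Suc t) \<omega>)"
      by (auto simp: walk_def fun_eq_iff)
    then show ?case by simp
  qed
  then show ?thesis
    unfolding scenery_along_walk_def[abs_def]
    by (rule measurable_compose_countable[OF assms(2)])
qed

lemma walk_up:
  assumes "\<forall>i\<in>{1..k}. X i \<omega> = 1" and "t \<le> k"
  shows "walk X t \<omega> = int t"
  using assms by (simp add: walk_def)

lemma walk_up_down:
  assumes "\<forall>i\<in>{1..2 * k}. X i \<omega> = (if i \<le> k then 1 else -1)"
  shows "walk X (2 * k) \<omega> = 0"
proof -
  have split: "{1..2 * k} = {1..k} \<union> {k + 1..2 * k}" by auto
  have "walk X (2 * k) \<omega> = (\<Sum>i=1..k. X i \<omega>) + (\<Sum>i=k+1..2*k. X i \<omega>)"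
    unfolding walk_def split by (rule sum.union_disjoint) auto
  also have "(\<Sum>i=1..k. X i \<omega>) = (\<Sum>i=1..k. 1)"
    using assms by (intro sum.cong) auto
  also have "(\<Sum>i=k+1..2*k. X i \<omega>) = (\<Sum>i=k+1..2*k. -1)"
    using assms by (intro sum.cong) auto
  finally show ?thesis by simp
qed

lemma (in prob_space) prob_indep_vars_eq:
  assumes "indep_vars (\<lambda>_. count_space UNIV) X I" and "finite J" and "J \<noteq> {}" and "J \<subseteq> I"
  shows "prob {\<omega> \<in> space M. \<forall>i\<in>J. X i \<omega> = x i} = (\<Prod>i\<in>J. prob {\<omega> \<in> space M. X i \<omega> = x i})"
proof -
  have "prob (\<Inter>i\<in>J. X i -` {x i} \<inter> space M) = (\<Prod>i\<in>J. prob (X i -` {x i} \<inter> space M))"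
    using assms by (intro indep_varsD[where I=I]) auto
  moreover have "(\<Inter>i\<in>J. X i -` {x i} \<inter> space M) = {\<omega> \<in> space M. \<forall>i\<in>J. X i \<omega> = x i}"
    using assms(3) by auto
  moreover have "X i -` {x i} \<inter> space M = {\<omega> \<in> space M. X i \<omega> = x i}" for i
    by auto
  ultimately show ?thesis by simp
qed

lemma (in prob_space) indep_elems_prob:
  assumes "indep_elems M S Y T Z" and "A \<in> sets S" and "B \<in> sets T"
  shows "prob {\<omega> \<in> space M. Y \<omega> \<in> A \<and> Z \<omega> \<in> B} =
    prob {\<omega> \<in> space M. Y \<omega> \<in> A} * prob {\<omega> \<in> space M. Z \<omega> \<in> B}"
proof -
  have "prob ((Y -` A \<inter> space M) \<inter> (Z -` B \<inter> space M)) =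
      prob (Y -` A \<inter> space M) * prob (Z -` B \<inter> space M)"
    using assms unfolding indep_elems_def by (intro indep_setD) auto
  moreover have "(Y -` A \<inter> space M) \<inter> (Z -` B \<inter> space M) = {\<omega> \<in> space M. Y \<omega> \<in> A \<and> Z \<omega> \<in> B}"
    "Y -` A \<inter> space M = {\<omega> \<in> space M. Y \<omega> \<in> A}" "Z -` B \<inter> space M = {\<omega> \<in> space M. Z \<omega> \<in> B}"
    by auto
  ultimately show ?thesis by simp
qed

text \<open>At a fixed level \<open>v\<close>, the scenery event (\<open>\<xi> 0\<close> exceeds
  \<open>v\<close>, no site of \<open>J\<close> does) and the path event (\<open>k\<close> steps up,
  then \<open>k\<close> down) are independent, and together they force the event on the right. All
  that is asked of \<open>J\<close> is to contain the sites \<open>1, ..., k - 1\<close> visited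
  before time \<open>k\<close>, so the two-sided window of the theorem fits.\<close>

lemma (in prob_space) return_prob_ge:
  assumes ind: "indep_vars (\<lambda>_. count_space UNIV) X {1..}"
    and up: "\<And>i. i \<ge> 1 \<Longrightarrow> prob {\<omega> \<in> space M. X i \<omega> = 1} = p"
    and down: "\<And>i. i \<ge> 1 \<Longrightarrow> prob {\<omega> \<in> space M. X i \<omega> = -1} = 1 - p"
    and scenery: "\<And>s. \<xi> s \<in> borel_measurable M"
    and ie: "indep_elems M
           (PiM (UNIV :: int set) (\<lambda>_. borel)) (\<lambda>\<omega> s. \<xi> s \<omega>)
           (PiM {1..} (\<lambda>_. count_space UNIV)) (\<lambda>\<omega>. \<lambda>i\<in>{1..}. X i \<omega>)"
    and k: "k \<ge> 1" and r: "2 * k \<le> r" and J: "\<And>t. 1 \<le> t \<Longrightarrow> t < k \<Longrightarrow> int t \<in> J"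
  shows "p ^ k * (1 - p) ^ k *
      (prob {\<omega> \<in> space M. \<xi> 0 \<omega> > v} - prob {\<omega> \<in> space M. \<xi> 0 \<omega> > v \<and>
         (\<exists>s \<in> J. \<xi> s \<omega> > v)})
    \<le> prob {\<omega> \<in> space M. scenery_along_walk \<xi> X 0 \<omega> > v \<and>
         ereal v \<ge> partial_max (scenery_along_walk \<xi> X) 1 (k - 1) \<omega> \<and>
         partial_max (scenery_along_walk \<xi> X) k r \<omega> > ereal v}"
    (is "_ * (prob ?E - prob ?F) \<le> prob ?G")
proof -
  note [measurable] = scenery
  have [measurable]: "X i \<in> measurable M (count_space UNIV)" if "i \<ge> 1" for i
    using ind that by (auto simp: indep_vars_def)
  have [measurable]: "scenery_along_walk \<xi> X t \<in> borel_measurable M" for t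
    by (intro borel_measurable_scenery_along_walk) auto
  \<comment> \<open>\<open>x\<close> lists the steps of the path. Both events are encoded as sets in
    the product spaces, so that independence of the two random elements applies to them.\<close>
  define x :: "nat \<Rightarrow> int" where "x = (\<lambda>i. if i \<le> k then 1 else - 1)"
  define A where "A = {f \<in> space (PiM (UNIV :: int set) (\<lambda>_. borel :: real measure)).
    f 0 > v \<and> (\<forall>s\<in>J. f s \<le> v)}"
  define B where "B = {g \<in> space (PiM {1::nat..} (\<lambda>_. count_space (UNIV :: int set))).
    \<forall>i\<in>{1..2 * k}. g i = x i}"
  have A: "A \<in> sets (PiM UNIV (\<lambda>_. borel))"
    \<comment> \<open>\<open>J\<close> consists of integers, hence is countable, and countably many
      coordinate constraints define a measurable set.\<close>
    unfolding A_def by measurable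
  have B: "B \<in> sets (PiM {1..} (\<lambda>_. count_space UNIV))"
  proof -
    have [measurable]: "(\<lambda>g. g i) \<in> measurable (PiM {1..} (\<lambda>_. count_space UNIV)) (count_space UNIV)"
      if "i \<in> {1..2 * k}" for i
      using that by (intro measurable_component_singleton) auto
    show ?thesis unfolding B_def by measurable
  qed
  have eqA: "{\<omega> \<in> space M. (\<lambda>s. \<xi> s \<omega>) \<in> A} = ?E - ?F"
    by (auto simp: A_def space_PiM not_less)
  have eqB: "{\<omega> \<in> space M. (\<lambda>i\<in>{1..}. X i \<omega>) \<in> B} =
      {\<omega> \<in> space M. \<forall>i\<in>{1..2 * k}. X i \<omega> = x i}"
    by (auto simp: B_def space_PiM)
  have "prob {\<omega> \<in> space M. \<forall>i\<in>{1..2 * k}. X i \<omega> = x i} =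
      (\<Prod>i=1..2*k. prob {\<omega> \<in> space M. X i \<omega> = x i})"
    using k by (intro prob_indep_vars_eq[OF ind]) auto
  also have "\<dots> = (\<Prod>i=1..k. prob {\<omega> \<in> space M. X i \<omega> = x i}) *
      (\<Prod>i=k+1..2*k. prob {\<omega> \<in> space M. X i \<omega> = x i})"
  proof -
    have split: "{1..2 * k} = {1..k} \<union> {k + 1..2 * k}" by auto
    show ?thesis unfolding split by (rule prod.union_disjoint) auto
  qed
  also have "(\<Prod>i=1..k. prob {\<omega> \<in> space M. X i \<omega> = x i}) = (\<Prod>i=1..k. p)"
    using up by (intro prod.cong) (auto simp: x_def)
  also have "(\<Prod>i=k+1..2*k. prob {\<omega> \<in> space M. X i \<omega> = x i}) = (\<Prod>i=k+1..2*k. 1 - p)"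
    using down by (intro prod.cong) (auto simp: x_def)
  finally have probB: "prob {\<omega> \<in> space M. (\<lambda>i\<in>{1..}. X i \<omega>) \<in> B} = p ^ k * (1 - p) ^ k"
    unfolding eqB by simp
  have probA: "prob {\<omega> \<in> space M. (\<lambda>s. \<xi> s \<omega>) \<in> A} = prob ?E - prob ?F"
    \<comment> \<open>\<open>?F\<close> is contained in \<open>?E\<close>, so the probabilities
      subtract.\<close>
    unfolding eqA by (rule finite_measure_Diff) auto
  have "{\<omega> \<in> space M. (\<lambda>s. \<xi> s \<omega>) \<in> A \<and> (\<lambda>i\<in>{1..}. X i \<omega>) \<in> B} \<subseteq> ?G"
  proof
    fix \<omega>
    assume "\<omega> \<in> {\<omega> \<in> space M. (\<lambda>s. \<xi> s \<omega>) \<in> A \<and> (\<lambda>i\<in>{1..}. X i \<omega>) \<in> B}"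
    then have \<omega>: "\<omega> \<in> space M" "\<xi> 0 \<omega> > v" "\<forall>s\<in>J. \<xi> s \<omega> \<le> v"
      and path: "\<forall>i\<in>{1..2 * k}. X i \<omega> = x i"
      by (auto simp: A_def B_def)
    have "\<forall>i\<in>{1..k}. X i \<omega> = 1"
      using path by (auto simp: x_def)
    \<comment> \<open>At time \<open>t < k\<close> the walk stands at site \<open>t\<close>, which
      lies in \<open>J\<close>.\<close>
    then have "\<forall>t\<in>{1..k - 1}. scenery_along_walk \<xi> X t \<omega> \<le> v"
      using \<omega>(3) J by (auto simp: scenery_along_walk_def walk_up)
    moreover have "scenery_along_walk \<xi> X (2 * k) \<omega> > v"
      using \<omega>(2) walk_up_down[where X=X and k=k and \<omega>=\<omega>, OF path[unfolded x_def]]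
      by (simp add: scenery_along_walk_def)
    moreover have "2 * k \<in> {k..r}"
      using r by auto
    ultimately show "\<omega> \<in> ?G"
      using \<omega>(1,2) unfolding partial_max_le_iff less_partial_max_iff
      by (auto simp: scenery_along_walk_def walk_def)
  qed
  moreover have "?G \<in> events"
    unfolding partial_max_le_iff less_partial_max_iff by measurable
  ultimately have "prob {\<omega> \<in> space M. (\<lambda>s. \<xi> s \<omega>) \<in> A \<and> (\<lambda>i\<in>{1..}. X i \<omega>) \<in> B} \<le> prob ?G"
    by (rule finite_measure_mono)
  then show ?thesis
    unfolding indep_elems_prob[OF ie A B] probA probB by (simp only: mult.commute)
qed

theorem proposition2:
  fixes M :: "'a measure"
    and X :: "nat \<Rightarrow> 'a \<Rightarrow> int"
    and \<xi> :: "int \<Rightarrow> 'a \<Rightarrow> real"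
    and u :: "nat \<Rightarrow> real"
    and p \<tau> :: real
    and k :: nat
  assumes "prob_space M"
    and "0 < p" and "p < 1" and "p \<noteq> 1/2"
    and "prob_space.indep_vars M (\<lambda>_. count_space UNIV) X {1..}"
    and "\<And>i. i \<ge> 1 \<Longrightarrow> \<P>(\<omega> in M. X i \<omega> = 1) = p"
    and "\<And>i. i \<ge> 1 \<Longrightarrow> \<P>(\<omega> in M. X i \<omega> = -1) = 1 - p"
    and "stationary_seq M \<xi>"
    and "indep_elems M
           (PiM (UNIV :: int set) (\<lambda>_. borel)) (\<lambda>\<omega> s. \<xi> s \<omega>)
           (PiM {1..} (\<lambda>_. count_space UNIV)) (\<lambda>\<omega>. \<lambda>i\<in>{1..}. X i \<omega>)"
    and "k \<ge> 1"
    and "\<tau> > 0"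
    and "\<And>n. u n > 0"
    and "(\<lambda>n. real n * \<P>(\<omega> in M. \<xi> 0 \<omega> > u n)) \<longlonglongrightarrow> \<tau>"
    and "limsup (\<lambda>n. ereal (real n * \<P>(\<omega> in M. \<xi> 0 \<omega> > u n \<and>
            (\<exists>s \<in> {- int k + 1 .. int k - 1} - {0}. \<xi> s \<omega> > u n)))) < ereal \<tau>"
  shows "\<not> D_cond k M (scenery_along_walk \<xi> X) u"
proof
  interpret prob_space M by fact
  assume "D_cond k M (scenery_along_walk \<xi> X) u"
  then obtain s l :: "nat \<Rightarrow> nat" where
    l: "\<forall>\<^sub>F n in sequentially. 1 \<le> l n \<and> l n \<le> n - 1"
    and s: "filterlim s at_top sequentially"
    and sl: "(\<lambda>n. real (s n) * real (l n) / real n) \<longlonglongrightarrow> 0"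
    and lim: "(\<lambda>n. real n * \<P>(\<omega> in M. scenery_along_walk \<xi> X 0 \<omega> > u n
        \<and> ereal (u n) \<ge> partial_max (scenery_along_walk \<xi> X) 1 (k - 1) \<omega>
        \<and> partial_max (scenery_along_walk \<xi> X) k (nat \<lfloor>real n / real (s n)\<rfloor>) \<omega> > ereal (u n))) \<longlonglongrightarrow> 0"
      (is "(\<lambda>n. real n * ?G n) \<longlonglongrightarrow> 0")
    unfolding D_cond_def by (elim conjE exE)
  let ?E = "\<lambda>n. \<P>(\<omega> in M. \<xi> 0 \<omega> > u n)"
  let ?F = "\<lambda>n. \<P>(\<omega> in M. \<xi> 0 \<omega> > u n \<and>
    (\<exists>s \<in> {- int k + 1 .. int k - 1} - {0}. \<xi> s \<omega> > u n))"
  have scenery: "\<xi> s \<in> borel_measurable M" for s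
    using assms(8) by (simp add: stationary_seq_def)
  \<comment> \<open>The level \<open>c\<close> separates the two quantities: \<open>n * ?F n\<close>
    is eventually below it, while \<open>n * ?E n\<close> tends to \<open>\<tau> > c\<close>. The
    gap \<open>\<tau> - c\<close> then survives in the limit.\<close>
  obtain c where c: "limsup (\<lambda>n. ereal (real n * ?F n)) < ereal c" "c < \<tau>"
    using ereal_dense2[OF assms(14)] by auto
  have F: "\<forall>\<^sub>F n in sequentially. real n * ?F n < c"
    using Limsup_lessD[OF c(1)] by simp
  have r: "\<forall>\<^sub>F n in sequentially. 2 * k \<le> nat \<lfloor>real n / real (s n)\<rfloor>"
  proof -
    \<comment> \<open>The threshold is chosen so that, with \<open>l n \<ge> 1\<close>, it gives
      \<open>s n < n / (2 * k)\<close>, that is \<open>n / s n > 2 * k\<close>.\<close>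
    have "\<forall>\<^sub>F n in sequentially. real (s n) * real (l n) / real n < 1 / (2 * real k)"
      using assms(10) by (intro order_tendstoD(2)[OF sl]) auto
    \<comment> \<open>Excludes \<open>s n = 0\<close>, where the quotient \<open>n / s n\<close>
      takes the default value \<open>0\<close>.\<close>
    moreover have "\<forall>\<^sub>F n in sequentially. 1 \<le> s n"
      using s by (simp add: filterlim_at_top)
    ultimately show ?thesis
      using l
    proof eventually_elim
      case (elim n)
      \<comment> \<open>With truncated subtraction, \<open>1 \<le> l n \<le> n - 1\<close> forces
        \<open>n \<ge> 2\<close>.\<close>
      have "0 < real n"
        using elim by linarith
      have "real (s n) \<le> real (s n) * real (l n)"
        using elim by simp
      also have "\<dots> < real n / (2 * real k)"
        using elim(1) \<open>0 < real n\<close> by (simp add: field_simps)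
      finally have "2 * real k \<le> real n / real (s n)"
        using elim assms(10) by (simp add: field_simps)
      then show ?case
        by (intro le_nat_floor) simp
    qed
  qed
  have pos: "0 < p ^ k * (1 - p) ^ k"
    using assms(2,3) by simp
  have "\<forall>\<^sub>F n in sequentially. p ^ k * (1 - p) ^ k * (real n * ?E n - c) \<le> real n * ?G n"
    using F r
  proof eventually_elim
    case (elim n)
    have "p ^ k * (1 - p) ^ k * (real n * ?E n - c)
        \<le> p ^ k * (1 - p) ^ k * (real n * ?E n - real n * ?F n)"
      using elim(1) pos by (intro mult_left_mono) auto
    also have "\<dots> = real n * (p ^ k * (1 - p) ^ k * (?E n - ?F n))"
      by (simp add: algebra_simps)
    also have "\<dots> \<le> real n * ?G n"
      \<comment> \<open>\<open>J\<close> is the punctured window around \<open>0\<close>, which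
        contains \<open>1, ..., k - 1\<close>.\<close>
      using elim(2) assms(10)
      by (intro mult_left_mono return_prob_ge[OF assms(5-7) scenery assms(9)]) auto
    finally show ?case .
  qed
  moreover have "(\<lambda>n. p ^ k * (1 - p) ^ k * (real n * ?E n - c)) \<longlonglongrightarrow> p ^ k * (1 - p) ^ k * (\<tau> - c)"
    by (intro tendsto_intros assms(13))
  \<comment> \<open>The eventual inequality passes to the limit; its right-hand side vanishes there
    by \<open>lim\<close>, against the positivity of the left-hand limit.\<close>
  ultimately have "p ^ k * (1 - p) ^ k * (\<tau> - c) \<le> 0"
    by (intro tendsto_le[OF _ lim]) auto
  moreover have "0 < p ^ k * (1 - p) ^ k * (\<tau> - c)"
    using pos c(2) by (simp only: zero_less_mult_iff diff_gt_0_iff_gt) simp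
  ultimately show False by simp
qed

end
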